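(* Let $H \in \mathbb{N}$ have Zeckendorf expansion \[ H = F_{m_0} + F_{m_1} + \cdots + F_{m_k}, \] where $k \ge 0$, $m_{i-1} - m_i \ge 2$ for $1 \le i \le k$, and $m_k \ge 2$. Write \[ x_\ell = F_{m_\ell} + \cdots + F_{m_k} \quad (0 \le \ell \le k+1) \] (so $x_{k+1} = 0$), and \[ t_i = \Big\lfloor \frac{m_{i-1} - m_i + 2}{2} \Big\rfloor, \qquad \varepsilon_i = 2t_i - 1 - m_{i-1} + m_i \qquad (1 \le i \le k). \] Let \[ a_0 = 1, \qquad a_1 = t_1, \qquad a_{\ell+1} = t_{\ell+1} a_\ell - \varepsilon_\ell a_{\ell-1} \quad (1 \le \ell \le k-1). \] Then \[ R(H) = \begin{cases} a_k \lfloor m_k/2 \rfloor - \varepsilon_k a_{k-1}, & \text{if } k \ge 1,\\ \lfloor m_0/2 \rfloor, & \text{if } k = 0. \end{cases} \]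
   Context: The Fibonacci numbers are $F_1 = F_2 = 1$, $F_{m+1} = F_m + F_{m-1}$. For $n \in \mathbb{Z}_{\ge 0}$, $R(n)$ is the number of solutions to $x_1 + \cdots + x_s = n$ with $s \in \mathbb{Z}_{\ge 0}$ and $x_1 < x_2 < \cdots < x_s$ Fibonacci numbers (i.e. the number of partitions of $n$ into distinct Fibonacci numbers; $R(0) = 1$). The Zeckendorf expansion of a positive integer is its unique representation as a sum of non-consecutive Fibonacci numbers $F_{m}$ with indices $m \ge 2$. Empty sums are $0$. *)

theory Defs
  imports "HOL-Number_Theory.Fib"
begin

definition fibonacci_numbers :: "nat set" where
  "fibonacci_numbers = {fib m | m. m \<ge> 1}"

text \<open>A solution \<open>x\<^sub>1 < \<dots> < x\<^sub>s\<close> is the strictly increasing list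
  \<open>[x\<^sub>1, \<dots>, x\<^sub>s]\<close>. The parts are numbers, not indices, so the part
  \<open>1 = fib 1 = fib 2\<close> is counted only once. For every \<open>n\<close> the set below is finite, because a
  solution is determined by a subset of \<open>{1..n}\<close>; hence \<^const>\<open>card\<close> is its true size.\<close>

definition R :: "nat \<Rightarrow> nat" where
  "R n = card {xs :: nat list. sorted_wrt (<) xs \<and> set xs \<subseteq> fibonacci_numbers \<and> sum_list xs = n}"

end

theory Submission
  imports Defs
begin

text \<open>
  Let \<open>n\<close> be an index exceeding the leading Zeckendorf index \<open>p\<close> of \<open>y\<close> by at least two, and put
  \<open>z = y - F\<^sub>p\<close>. In a partition of \<open>F\<^sub>n + y\<close> into distinct Fibonacci numbers either \<open>F\<^sub>n\<close> occurs,
  leaving a partition of \<open>y\<close>, or \<open>F\<^sub>n\<^sub>-\<^sub>1\<close> is forced, because all smaller parts together do not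
  suffice, and one is left with \<open>F\<^sub>n\<^sub>-\<^sub>2 + y\<close>. Descending in steps of two until \<open>F\<^sub>p\<close> interferes gives
  \<open>R (F\<^sub>n + y) = t R y - \<epsilon> R z\<close>. For the tails \<open>x\<^sub>l\<close> this is a three-term recurrence, and the numbers
  \<open>a\<^sub>l\<close> are the continuants that solve it: \<open>R H = a\<^sub>l R x\<^sub>l - \<epsilon>\<^sub>l a\<^sub>l\<^sub>-\<^sub>1 R x\<^sub>l\<^sub>+\<^sub>1\<close> for all \<open>l\<close>.
\<close>

section \<open>Partitions with a bound on the largest index\<close>

definition bounded_partitions :: "nat \<Rightarrow> nat \<Rightarrow> nat set set" where
  "bounded_partitions n N = {S. S \<subseteq> fib ` {2..n} \<and> \<Sum>S = N}"

definition bounded_R :: "nat \<Rightarrow> nat \<Rightarrow> nat" where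
  "bounded_R n N = card (bounded_partitions n N)"

lemma fib_less_mono: "2 \<le> i \<Longrightarrow> i < j \<Longrightarrow> fib i < fib j"
proof (induction j)
  case (Suc j)
  have "fib j < fib (Suc j)" if j: "2 \<le> j"
  proof -
    obtain j' where "j = Suc (Suc j')" using j by (cases j rule: fib.cases) auto
    then show ?thesis by (simp add: fib_neq_0_nat)
  qed
  with Suc show ?case by (cases "i = j") auto
qed simp

text \<open>Since \<open>fib 1 = fib 2\<close>, dropping index 1 loses no value, and
  \<open>fib\<close> is injective on the remaining indices; so the part 1 is never counted
  twice.\<close>

lemma fibonacci_numbers_eq: "fibonacci_numbers = fib ` {2..}"
proof
  show "fibonacci_numbers \<subseteq> fib ` {2..}"
  proof
    fix v assume "v \<in> fibonacci_numbers"
    then obtain m where m: "v = fib m" "m \<ge> 1" by (auto simp: fibonacci_numbers_def)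
    show "v \<in> fib ` {2..}"
    proof (cases "m = 1")
      case True
      then have "v = fib 2" using m by simp
      then show ?thesis by blast
    qed (use m in auto)
  qed
  show "fib ` {2..} \<subseteq> fibonacci_numbers"
    unfolding fibonacci_numbers_def by force
qed

lemma finite_bounded_partitions: "finite (bounded_partitions n N)"
  by (rule finite_subset [of _ "Pow (fib ` {2..n})"]) (auto simp: bounded_partitions_def)

text \<open>No part exceeds \<open>N\<close>, so every index is at most \<open>n\<close> and the
  bound excludes nothing; increasing lists correspond to their sets of entries.\<close>

lemma R_eq_bounded_R:
  assumes "N < fib (Suc n)"
  shows "R N = bounded_R n N"
proof -
  let ?L = "{xs :: nat list. sorted_wrt (<) xs \<and> set xs \<subseteq> fibonacci_numbers \<and> sum_list xs = N}"
  have sum_set: "\<Sum>(set xs) = sum_list xs" if "sorted_wrt (<) xs" for xs :: "nat list"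
    using that sum_list_distinct_conv_sum_set [of xs "\<lambda>x. x"]
    by (simp add: strict_sorted_iff)
  have "bij_betw set ?L (bounded_partitions n N)"
  proof (rule bij_betwI')
    fix xs ys assume "xs \<in> ?L" "ys \<in> ?L"
    then show "(set xs = set ys) = (xs = ys)"
      using strict_sorted_equal by auto
  next
    fix xs assume xs: "xs \<in> ?L"
    have "set xs \<subseteq> fib ` {2..n}"
    proof
      fix v assume v: "v \<in> set xs"
      then obtain i where i: "v = fib i" "2 \<le> i" using xs fibonacci_numbers_eq by auto
      have "v \<le> N" using v xs member_le_sum_list by blast
      then have "\<not> Suc n \<le> i" using assms fib_mono [of "Suc n" i] i by linarith
      then show "v \<in> fib ` {2..n}" using i by auto
    qed
    then show "set xs \<in> bounded_partitions n N"
      using xs sum_set by (auto simp: bounded_partitions_def)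
  next
    fix S assume S: "S \<in> bounded_partitions n N"
    then have fin: "finite S" by (auto simp: bounded_partitions_def intro: finite_subset)
    have "sorted_list_of_set S \<in> ?L"
      using S fin sum_set [of "sorted_list_of_set S"]
      by (auto simp: bounded_partitions_def fibonacci_numbers_eq)
    then show "\<exists>xs\<in>?L. S = set xs" using fin by (metis set_sorted_list_of_set)
  qed
  then show ?thesis unfolding R_def bounded_R_def by (rule bij_betw_same_card)
qed

lemma sum_fib_less: "\<Sum>(fib ` {2..n}) < fib (Suc (Suc n))"
proof (induction n)
  case (Suc n)
  show ?case
  proof (cases "n = 0")
    case False
    then have "{2..Suc n} = insert (Suc n) {2..n}" by auto
    then have "\<Sum>(fib ` {2..Suc n}) \<le> fib (Suc n) + \<Sum>(fib ` {2..n})"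
      by (simp add: sum.insert_if)
    then show ?thesis using Suc by simp
  qed simp
qed simp

lemma bounded_R_eq_0:
  assumes "fib (Suc (Suc n)) \<le> N"
  shows "bounded_R n N = 0"
proof -
  have "\<Sum>S \<noteq> N" if "S \<subseteq> fib ` {2..n}" for S
  proof -
    have "\<Sum>S \<le> \<Sum>(fib ` {2..n})" using that by (intro sum_mono2) auto
    then show ?thesis using sum_fib_less [of n] assms by linarith
  qed
  then have "bounded_partitions n N = {}" unfolding bounded_partitions_def by blast
  then show ?thesis by (simp add: bounded_R_def)
qed

text \<open>The two summands count the partitions without and with the part
  \<open>fib (Suc n)\<close>. Writing the target as \<open>fib (Suc n) + y\<close> avoids truncated
  subtraction.\<close>

lemma bounded_R_Suc:
  assumes "1 \<le> n"
  shows "bounded_R (Suc n) (fib (Suc n) + y) = bounded_R n (fib (Suc n) + y) + bounded_R n y"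
proof -
  let ?f = "fib (Suc n)"
  have notin: "?f \<notin> fib ` {2..n}"
  proof
    assume "?f \<in> fib ` {2..n}"
    then obtain i where "2 \<le> i" "i \<le> n" "?f = fib i" by auto
    then show False using fib_less_mono [of i "Suc n"] by simp
  qed
  have ins: "fib ` {2..Suc n} = insert ?f (fib ` {2..n})"
  proof -
    have "{2..Suc n} = insert (Suc n) {2..n}" using assms by auto
    then show ?thesis by simp
  qed
  have fin: "finite S" if "S \<subseteq> fib ` {2..n}" for S
    using that by (rule finite_subset) simp
  have eq: "bounded_partitions (Suc n) (?f + y)
      = bounded_partitions n (?f + y) \<union> insert ?f ` bounded_partitions n y" (is "?A = ?B \<union> ?C")
  proof
    show "?A \<subseteq> ?B \<union> ?C"
    proof
      fix S assume S: "S \<in> ?A"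
      show "S \<in> ?B \<union> ?C"
      proof (cases "?f \<in> S")
        case True
        have sub: "S - {?f} \<subseteq> fib ` {2..n}"
          using S by (auto simp: bounded_partitions_def ins)
        have "finite S" using S by (auto simp: bounded_partitions_def intro: finite_subset)
        then have "\<Sum>S = ?f + \<Sum>(S - {?f})" using True by (simp add: sum.remove)
        then have "S - {?f} \<in> bounded_partitions n y"
          using S sub by (simp add: bounded_partitions_def)
        moreover have "S = insert ?f (S - {?f})" using True by auto
        ultimately show ?thesis by blast
      next
        case False
        then show ?thesis using S by (auto simp: bounded_partitions_def ins)
      qed
    qed
    have "insert ?f S \<in> ?A" if "S \<in> bounded_partitions n y" for S
    proof -
      have sub: "S \<subseteq> fib ` {2..n}" "\<Sum>S = y" using that by (auto simp: bounded_partitions_def)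
      then have "?f \<notin> S" using notin by blast
      then have "\<Sum>(insert ?f S) = ?f + y" using fin [OF sub(1)] sub(2) by simp
      then show ?thesis using sub by (auto simp: bounded_partitions_def ins)
    qed
    moreover have "?B \<subseteq> ?A" by (auto simp: bounded_partitions_def ins)
    ultimately show "?B \<union> ?C \<subseteq> ?A" by blast
  qed
  have "inj_on (insert ?f) (bounded_partitions n y)"
  proof (rule inj_onI)
    fix S T assume "S \<in> bounded_partitions n y" "T \<in> bounded_partitions n y" "insert ?f S = insert ?f T"
    moreover from this have "?f \<notin> S" "?f \<notin> T" using notin by (auto simp: bounded_partitions_def)
    ultimately show "S = T" by (simp add: insert_ident)
  qed
  moreover have "?B \<inter> ?C = {}" using notin by (auto simp: bounded_partitions_def)
  ultimately show ?thesis
    by (simp add: bounded_R_def eq card_Un_disjoint finite_bounded_partitions card_image)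
qed

text \<open>The parts of index at most \<open>n\<close> sum to less than \<open>fib (n + 2)\<close>,
  so the part \<open>fib (n + 1)\<close> is forced; removing it leaves
  \<open>fib n + y\<close>.\<close>

lemma bounded_R_fib_shift:
  assumes "1 \<le> n"
  shows "bounded_R (Suc n) (fib (Suc (Suc n)) + y) = bounded_R n (fib n + y)"
  using bounded_R_Suc [OF assms, of "fib n + y"] bounded_R_eq_0 [of n "fib (Suc (Suc n)) + y"]
  by (simp add: add.assoc)

section \<open>Recurrences for R after adding a large Fibonacci number\<close>

lemma R_fib_add:
  assumes "1 \<le> n" and "y < fib n"
  shows "R (fib (Suc n) + y) = R y + bounded_R n (fib (Suc n) + y)"
proof -
  \<comment> \<open>As \<open>y < fib n\<close>, the total stays below \<open>fib (n + 2)\<close>,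
    so the bound \<open>n + 1\<close> is harmless.\<close>
  have "R (fib (Suc n) + y) = bounded_R (Suc n) (fib (Suc n) + y)"
    using assms by (intro R_eq_bounded_R) simp
  moreover have "R y = bounded_R n y"
    using assms fib_mono [of n "Suc n"] by (intro R_eq_bounded_R) simp
  ultimately show ?thesis using bounded_R_Suc [OF assms(1), of y] by simp
qed

text \<open>Without \<open>fib (n + 3)\<close> the part \<open>fib (n + 2)\<close> is forced. The
  rest \<open>fib (n + 1) + y\<close> is below \<open>fib (n + 2)\<close>, so its index bound
  disappears and the recurrence closes in \<open>R\<close>.\<close>

lemma R_fib_add_two_steps:
  assumes "1 \<le> n" and "y < fib n"
  shows "R (fib (n + 3) + y) = R (fib (n + 1) + y) + R y"
proof -
  have "R (fib (n + 3) + y) = R y + bounded_R (Suc (Suc n)) (fib (Suc (Suc (Suc n))) + y)"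
    using R_fib_add [of "n + 2" y] assms fib_mono [of n "n + 2"]
    by (simp add: eval_nat_numeral)
  also have "\<dots> = R y + bounded_R (Suc n) (fib (Suc n) + y)"
    using bounded_R_fib_shift [of "Suc n" y] by simp
  also have "bounded_R (Suc n) (fib (Suc n) + y) = R (fib (Suc n) + y)"
    using assms by (intro R_eq_bounded_R [symmetric]) simp
  finally show ?thesis by simp
qed

lemma R_0: "R 0 = 1"
proof -
  have "bounded_partitions 0 0 = {{}}" by (auto simp: bounded_partitions_def)
  then show ?thesis by (simp add: R_eq_bounded_R [of 0 0] bounded_R_def)
qed

lemma R_fib:
  assumes "2 \<le> n"
  shows "R (fib n) = n div 2"
proof -
  \<comment> \<open>The index range \<open>{2..1}\<close> is empty, so the target 1 cannot be
    reached.\<close>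
  have small: "bounded_R (Suc 0) (Suc 0) = 0"
  proof -
    have "bounded_partitions (Suc 0) (Suc 0) = {}" by (auto simp: bounded_partitions_def)
    then show ?thesis by (simp add: bounded_R_def)
  qed
  have R_1: "R (fib 2) = 1"
    using R_fib_add [of "Suc 0" 0] small R_0 by (simp add: numeral_2_eq_2)
  have R_2: "R (fib 3) = 1"
    using R_fib_add [of "Suc (Suc 0)" 0] bounded_R_fib_shift [of "Suc 0" 0] small R_0
    by (simp add: numeral_3_eq_3)
  have "R (fib (j + 2)) = (j + 2) div 2" for j
  proof (induction j rule: less_induct)
    case (less j)
    consider "j = 0" | "j = 1" | i where "j = i + 2"
      by (cases j rule: fib.cases) auto
    then show ?case
    proof cases
      case 1
      then show ?thesis using R_1 by simp
    next
      case 2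
      then have "j + 2 = 3" by simp
      then have "R (fib (j + 2)) = 1" using R_2 by (simp only:)
      then show ?thesis using 2 by simp
    next
      case 3
      then have "R (fib (j + 2)) = R (fib (i + 2)) + R 0"
        using R_fib_add_two_steps [of "i + 1" 0] by (simp add: fib_neq_0_nat eval_nat_numeral)
      then show ?thesis using less [of i] 3 R_0 by simp
    qed
  qed
  moreover obtain j where "n = j + 2" using assms by (metis le_add_diff_inverse2)
  ultimately show ?thesis by (simp only:)
qed

text \<open>Each descent by two indices contributes one \<open>R y\<close>, where
  \<open>y = fib p + z\<close>. The parity of \<open>d\<close> decides whether it ends at
  \<open>p + 2\<close> or \<open>p + 3\<close>, and only the even case loses
  \<open>R z\<close>.\<close>

lemma R_fib_add_fib_add:
  assumes "2 \<le> p" and "z < fib (p - 1)" and "2 \<le> d"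
  shows "int (R (fib (p + d) + (fib p + z)))
    = int ((d + 2) div 2) * int (R (fib p + z)) - (if even d then int (R z) else 0)"
proof -
  define y where "y = fib p + z"
  obtain q where q: "p = Suc q" "1 \<le> q" using assms(1) by (cases p) auto
  have y_less: "y < fib (Suc p)" using assms q by (cases q) (auto simp: y_def)
  have fib_le: "fib (Suc p) \<le> 2 * fib p" using q fib_mono [of "q - 1" p] by (cases q) auto
  have Ry: "R y = R z + bounded_R q y"
    using R_fib_add [of q z] q assms by (simp add: y_def)
  \<comment> \<open>Here \<open>fib p + y\<close> must be built from indices at most
    \<open>p\<close>. It is at least \<open>2 * fib p\<close>, so \<open>fib p\<close> is forced,
    leaving the partitions of \<open>y\<close> that avoid \<open>fib p\<close>: there are
    \<open>R y - R z\<close> of them.\<close>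
  have bottom: "R (fib (p + 2) + y) + R z = 2 * R y"
  proof -
    have "R (fib (p + 2) + y) = R y + bounded_R (Suc p) (fib (Suc (Suc p)) + y)"
      using R_fib_add [of "Suc p" y] y_less by simp
    also have "bounded_R (Suc p) (fib (Suc (Suc p)) + y) = bounded_R p (fib p + y)"
      using bounded_R_fib_shift [of p y] assms by simp
    also have "\<dots> = bounded_R q (fib p + y) + bounded_R q y"
      using bounded_R_Suc [of q y] q by simp
    also have "bounded_R q (fib p + y) = 0"
      using fib_le q by (intro bounded_R_eq_0) (simp add: y_def)
    finally show ?thesis using Ry by simp
  qed
  \<comment> \<open>Now \<open>fib (p + 1) + y\<close> is at least \<open>fib (p + 2)\<close>, so
    \<open>fib p\<close> is forced; what remains is \<open>y\<close> with indices at most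
    \<open>p\<close>, which is no restriction.\<close>
  have bottom': "R (fib (p + 3) + y) = 2 * R y"
  proof -
    have "R (fib (p + 3) + y) = R y + bounded_R (Suc (Suc p)) (fib (Suc (Suc (Suc p))) + y)"
      using R_fib_add [of "Suc (Suc p)" y] y_less by (simp add: eval_nat_numeral)
    also have "bounded_R (Suc (Suc p)) (fib (Suc (Suc (Suc p))) + y)
        = bounded_R (Suc p) (fib (Suc p) + y)"
      using bounded_R_fib_shift [of "Suc p" y] by simp
    also have "\<dots> = bounded_R p (fib (Suc p) + y) + bounded_R p y"
      using bounded_R_Suc [of p y] assms by simp
    also have "bounded_R p (fib (Suc p) + y) = 0"
      by (intro bounded_R_eq_0) (simp add: y_def)
    also have "bounded_R p y = R y"
      using y_less by (simp add: R_eq_bounded_R)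
    finally show ?thesis by simp
  qed
  have "int (R (fib (p + (j + 2)) + y))
      = int ((j + 4) div 2) * int (R y) - (if even j then int (R z) else 0)" for j
  proof (induction j rule: less_induct)
    case (less j)
    consider "j = 0" | "j = 1" | i where "j = i + 2"
      by (cases j rule: fib.cases) auto
    then show ?case
    proof cases
      case 1
      then show ?thesis using bottom by simp
    next
      case 2
      then have "p + (j + 2) = p + 3" by simp
      then have "R (fib (p + (j + 2)) + y) = 2 * R y" using bottom' by (simp only:)
      then show ?thesis using 2 by simp
    next
      case 3
      have "y < fib (p + i + 1)" using y_less fib_mono [of "Suc p" "p + i + 1"] by simp
      then have "R (fib (p + (j + 2)) + y) = R (fib (p + (i + 2)) + y) + R y"
        using R_fib_add_two_steps [of "p + i + 1" y] 3 by (simp add: eval_nat_numeral)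
      moreover have "(j + 4) div 2 = Suc ((i + 4) div 2)" using 3 by simp
      ultimately show ?thesis using less [of i] 3 by (simp add: distrib_right)
    qed
  qed
  moreover obtain j where "d = j + 2" using assms(3) by (metis le_add_diff_inverse2)
  moreover from this have "(d + 2) div 2 = (j + 4) div 2" by simp
  ultimately show ?thesis by (simp only: y_def) simp
qed

section \<open>The recurrence along the Zeckendorf tails\<close>

theorem theorem1p1:
  fixes H k :: nat and m x :: "nat \<Rightarrow> nat" and t \<epsilon> a :: "nat \<Rightarrow> int"
  assumes H: "H = (\<Sum>i=0..k. fib (m i))"
    and gap: "\<And>i. 1 \<le> i \<Longrightarrow> i \<le> k \<Longrightarrow> int (m (i - 1)) - int (m i) \<ge> 2"
    and last: "m k \<ge> 2"
    and x: "\<And>l. l \<le> k + 1 \<Longrightarrow> x l = (\<Sum>i=l..k. fib (m i))"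
    and t: "\<And>i. 1 \<le> i \<Longrightarrow> i \<le> k \<Longrightarrow> t i = (int (m (i - 1)) - int (m i) + 2) div 2"
    and eps: "\<And>i. 1 \<le> i \<Longrightarrow> i \<le> k \<Longrightarrow> \<epsilon> i = 2 * t i - 1 - int (m (i - 1)) + int (m i)"
    and a0: "a 0 = 1"
    and a1: "k \<ge> 1 \<Longrightarrow> a 1 = t 1"
    and a_rec: "\<And>l. 1 \<le> l \<Longrightarrow> l + 1 \<le> k \<Longrightarrow> a (l + 1) = t (l + 1) * a l - \<epsilon> l * a (l - 1)"
  shows "int (R H) = (if k \<ge> 1 then a k * (int (m k) div 2) - \<epsilon> k * a (k - 1)
                      else int (m 0) div 2)"
proof -
  define X where "X l = (\<Sum>i=l..k. fib (m i))" for l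
  have X_end: "X (Suc k) = 0" by (simp add: X_def)
  have X_rec: "X l = fib (m l) + X (Suc l)" if "l \<le> k" for l
    using that by (simp add: X_def sum.atLeast_Suc_atMost)
  have gap': "m (Suc l) + 2 \<le> m l" if "Suc l \<le> k" for l
    using gap [of "Suc l"] that by simp
  \<comment> \<open>Downward induction from \<open>k\<close>: the tail \<open>X (Suc l)\<close> lies
    below \<open>fib (m (Suc l) + 1)\<close>, and the gap of two turns this into
    \<open>fib (m l - 1)\<close>.\<close>
  have bounds: "2 \<le> m l \<and> X (Suc l) < fib (m l - 1)" if "l \<le> k" for l
    using that
  proof (induction rule: inc_induct)
    case base
    then show ?case using last X_end by (simp add: fib_neq_0_nat)
  next
    case (step l)
    have "X (Suc l) < fib (Suc (m (Suc l)))"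
      using step X_rec [of "Suc l"] by (cases "m (Suc l)") (auto simp: fib.simps(3) dest: gr0_implies_Suc)
    also have "\<dots> \<le> fib (m l - 1)" using gap' [of l] step by (intro fib_mono) simp
    finally show ?case using gap' [of l] step by simp
  qed
  have R_rec: "int (R (X l)) = t (Suc l) * int (R (X (Suc l))) - \<epsilon> (Suc l) * int (R (X (Suc (Suc l))))"
    if "Suc l \<le> k" for l
  proof -
    define d where "d = m l - m (Suc l)"
    have d: "2 \<le> d" "m l = m (Suc l) + d" using gap' [OF that] by (auto simp: d_def)
    have t': "t (Suc l) = int ((d + 2) div 2)"
      using t [of "Suc l"] that d by (simp add: zdiv_int)
    \<comment> \<open>By the floor in \<open>t\<close>, the number \<epsilon> is just the indicator
      of an even gap.\<close>
    have e': "\<epsilon> (Suc l) = (if even d then 1 else 0)"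
      using eps [of "Suc l"] that d t' by (auto elim!: evenE oddE)
    show ?thesis
      using R_fib_add_fib_add [of "m (Suc l)" "X (Suc (Suc l))" d] bounds [of "Suc l"] that d
        X_rec [of l] X_rec [of "Suc l"] t' e' by simp
  qed
  have continuant: "int (R (X 0)) = a (Suc l) * int (R (X (Suc l))) - \<epsilon> (Suc l) * a l * int (R (X (Suc (Suc l))))"
    if "Suc l \<le> k" for l
    using that
  proof (induction l)
    case 0
    then show ?case using R_rec [of 0] a0 a1 by simp
  next
    case (Suc l)
    have "a (Suc (Suc l)) = t (Suc (Suc l)) * a (Suc l) - \<epsilon> (Suc l) * a l"
      using a_rec [of "Suc l"] Suc by simp
    \<comment> \<open>Expanding \<open>R (X (Suc l))\<close> by \<open>R_rec\<close> gives
      \<open>R (X (Suc (Suc l)))\<close> exactly the coefficient in \<open>a_rec\<close>.\<close>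
    then show ?case using Suc R_rec [of "Suc l"] by (simp add: left_diff_distrib right_diff_distrib)
  qed
  have R_last: "int (R (X k)) = int (m k) div 2"
    using X_rec [of k] X_end R_fib [OF last] by (simp add: zdiv_int)
  have "H = X 0" using H by (simp add: X_def)
  \<comment> \<open>For \<open>k\<close> positive, the last instance involves only
    \<open>X k = fib (m k)\<close> and the empty tail, with \<open>R 0 = 1\<close>; for
    \<open>k = 0\<close>, \<open>R_last\<close> already is the claim.\<close>
  then show ?thesis
    using continuant [of "k - 1"] R_last X_end R_0 by (cases k) (auto simp: mult.commute)
qed

end
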